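(* Let $(x_i,a_i,y_i)_{i=1}^n$ be training data with $x_i\in\mathcal{X}$, $a_i\in\mathcal{A}$, $y_i\in\{-1,+1\}$, let $\mathcal{H}$ be a class of weak learners $h:\mathcal{X}\to\{-1,+1\}$, let $g:[n]\to\mathbb{R}^K$ be bounded constraint features, and let $\epsilon>0$. Consider a run of $T$ rounds of the projected fair boosting algorithm (described in the context), producing for $t=1,\dots,T$ the exponential-weights distributions $q^t$, the projected distributions $w^t$, the weak learners $h_t$, the coefficients $\alpha_t$ and the ensembles $f_t$. Let $$\gamma_t^{(w)}=\frac12\sum_{i=1}^n w_i^t\,y_i h_t(x_i)$$ be the edge of $h_t$ under $w^t$, and let $\delta_t=\sqrt{\mathrm{KL}(w^t\,\|\,q^t)/2}$. Suppose $\gamma_t^{(w)}>\delta_t$ for all $t=1,\dots,T$. Then $$L_{\exp}(f_T)\le n\exp\Big(-2\sum_{t=1}^T\big(\gamma_t^{(w)}-\delta_t\big)^2\Big),$$ and consequently the training error satisfies $$\frac1n\sum_{i=1}^n\mathbf{1}\big[\mathrm{sign}(f_T(x_i))\neq y_i\big]\le\exp\Big(-2\sum_{t=1}^T\big(\gamma_t^{(w)}-\delta_t\big)^2\Big).$$ Moreover, $\big|\sum_{i=1}^n w_i^t g_k(i)\big|\le\epsilon$ for all $k\in[K]$ and all $t=1,\dots,T$.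
   Context: Notation: $[n]=\{1,\dots,n\}$; $\Delta_n=\{w\in\mathbb{R}^n: w_i\ge 0,\ \sum_i w_i=1\}$; $\mathrm{KL}(w\|q)=\sum_i w_i\log(w_i/q_i)$ with $0\log 0=0$. The exponential loss of $f:\mathcal{X}\to\mathbb{R}$ is the unnormalized sum $L_{\exp}(f)=\sum_{i=1}^n\exp(-y_i f(x_i))$. Constraint set: $g=(g_1,\dots,g_K):[n]\to\mathbb{R}^K$ satisfies $|g_k(i)|\le G$ for all $k,i$ and some constant $G$, and $$\mathcal{C}_\epsilon=\Big\{w\in\Delta_n:\ \Big|\sum_{i=1}^n w_i g_k(i)\Big|\le\epsilon\ \ \forall k\in[K]\Big\},$$ assumed nonempty. Algorithm (projected fair boosting): start with $f_0\equiv 0$. For $t=1,\dots,T$: (1) set $q_i^t=\dfrac{\exp(-y_i f_{t-1}(x_i))}{\sum_{j=1}^n\exp(-y_j f_{t-1}(x_j))}$ for $i\in[n]$; (2) let $w^t=\arg\min_{w\in\mathcal{C}_\epsilon}\mathrm{KL}(w\|q^t)$; (3) choose a weak learner $h_t\in\mathcal{H}$ (fit with sample weights $w^t$; no property of the fitting procedure is assumed beyond the hypotheses in the claim); (4) compute $\varepsilon_t^{(q)}=\sum_{i=1}^n q_i^t\,\mathbf{1}[y_i\neq h_t(x_i)]$ and stop if $\varepsilon_t^{(q)}\ge\frac12$; (5) set $\alpha_t=\frac12\ln\dfrac{1-\varepsilon_t^{(q)}}{\varepsilon_t^{(q)}}$ and $f_t=f_{t-1}+\alpha_t h_t$. It is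 understood that all $T$ rounds are carried out with each $\alpha_t$ a well-defined real number, i.e. $\varepsilon_t^{(q)}>0$ for every $t$. *)

theory Defs
  imports "HOL-Analysis.Analysis"
begin

text \<open>
  The sample indices \<open>1, ..., n\<close> are the elements of a finite type \<open>'n\<close>, so \<open>n = CARD('n)\<close>.
  Labels and weak learners are real-valued functions whose values are required to be \<open>-1\<close> or \<open>1\<close>.
\<close>

definition prob_simplex :: "(real ^ 'n::finite) set"
  where "prob_simplex = {w. (\<forall>i. 0 \<le> w $ i) \<and> (\<Sum>i\<in>UNIV. w $ i) = 1}"

text \<open>
  The convention \<open>0 log 0 = 0\<close> holds automatically, since the factor \<open>w $ i = 0\<close> annihilates the
  summand. The definition is meant for \<open>q\<close> with positive entries (no value \<open>\<infinity>\<close>);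
  exponential weights always have positive entries.
\<close>
definition KL :: "real ^ 'n::finite \<Rightarrow> real ^ 'n \<Rightarrow> real"
  where "KL w q = (\<Sum>i\<in>UNIV. w $ i * ln (w $ i / q $ i))"

definition exp_loss :: "('n::finite \<Rightarrow> 'x) \<Rightarrow> ('n \<Rightarrow> real) \<Rightarrow> ('x \<Rightarrow> real) \<Rightarrow> real"
  where "exp_loss x y f = (\<Sum>i\<in>UNIV. exp (- y i * f (x i)))"

text \<open>The library's \<open>sgn\<close> has \<open>sgn 0 = 0\<close>, so a tie \<open>f (x i) = 0\<close> counts as an error.\<close>
definition training_error :: "('n::finite \<Rightarrow> 'x) \<Rightarrow> ('n \<Rightarrow> real) \<Rightarrow> ('x \<Rightarrow> real) \<Rightarrow> real"
  where "training_error x y f =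
    1 / real CARD('n) * (\<Sum>i\<in>UNIV. of_bool (sgn (f (x i)) \<noteq> y i))"

definition constraint_set :: "nat \<Rightarrow> (nat \<Rightarrow> 'n::finite \<Rightarrow> real) \<Rightarrow> real \<Rightarrow> (real ^ 'n) set"
  where "constraint_set K g \<epsilon> =
    {w \<in> prob_simplex. \<forall>k\<in>{1..K}. \<bar>\<Sum>i\<in>UNIV. w $ i * g k i\<bar> \<le> \<epsilon>}"

definition exp_weights :: "('n::finite \<Rightarrow> 'x) \<Rightarrow> ('n \<Rightarrow> real) \<Rightarrow> ('x \<Rightarrow> real) \<Rightarrow> real ^ 'n"
  where "exp_weights x y f =
    (\<chi> i. exp (- y i * f (x i)) / (\<Sum>j\<in>UNIV. exp (- y j * f (x j))))"

definition weighted_error ::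
    "('n::finite \<Rightarrow> 'x) \<Rightarrow> ('n \<Rightarrow> real) \<Rightarrow> real ^ 'n \<Rightarrow> ('x \<Rightarrow> real) \<Rightarrow> real"
  where "weighted_error x y q h = (\<Sum>i\<in>UNIV. q $ i * of_bool (y i \<noteq> h (x i)))"

definition edge :: "('n::finite \<Rightarrow> 'x) \<Rightarrow> ('n \<Rightarrow> real) \<Rightarrow> real ^ 'n \<Rightarrow> ('x \<Rightarrow> real) \<Rightarrow> real"
  where "edge x y w h = 1 / 2 * (\<Sum>i\<in>UNIV. w $ i * (y i * h (x i)))"

text \<open>
  The sequences \<open>q, w, h, \<alpha>, f\<close> form a run in which all \<open>T\<close> rounds are completed: the stopping test
  \<open>weighted_error \<ge> 1/2\<close> never succeeds, and \<open>weighted_error > 0\<close> makes each \<open>\<alpha> t\<close> a genuine real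
  number. Only the values at \<open>t \<in> {1..T}\<close> (and \<open>f 0\<close>) are constrained.
\<close>
definition fair_boosting_run ::
    "('n::finite \<Rightarrow> 'x) \<Rightarrow> ('n \<Rightarrow> real) \<Rightarrow> ('x \<Rightarrow> real) set \<Rightarrow>
     nat \<Rightarrow> (nat \<Rightarrow> 'n \<Rightarrow> real) \<Rightarrow> real \<Rightarrow> nat \<Rightarrow>
     (nat \<Rightarrow> real ^ 'n) \<Rightarrow> (nat \<Rightarrow> real ^ 'n) \<Rightarrow> (nat \<Rightarrow> 'x \<Rightarrow> real) \<Rightarrow>
     (nat \<Rightarrow> real) \<Rightarrow> (nat \<Rightarrow> 'x \<Rightarrow> real) \<Rightarrow> bool"
  where "fair_boosting_run x y H K g \<epsilon> T q w h \<alpha> f \<longleftrightarrow>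
    f 0 = (\<lambda>_. 0) \<and>
    (\<forall>t\<in>{1..T}.
       q t = exp_weights x y (f (t - 1)) \<and>
       is_arg_min (\<lambda>v. KL v (q t)) (\<lambda>v. v \<in> constraint_set K g \<epsilon>) (w t) \<and>
       h t \<in> H \<and>
       0 < weighted_error x y (q t) (h t) \<and>
       weighted_error x y (q t) (h t) < 1 / 2 \<and>
       \<alpha> t = 1 / 2 * ln ((1 - weighted_error x y (q t) (h t)) / weighted_error x y (q t) (h t)) \<and>
       f t = (\<lambda>z. f (t - 1) z + \<alpha> t * h t z))"

end

theory Submission
  imports Defs "HOL-Probability.Hoeffding"
begin

text \<open>
  The weight that a distribution puts on the correctly classified samples exceeds its edge by
  \<open>1/2\<close>, so Pinsker's inequality shows that passing from \<open>w t\<close> to \<open>q t\<close> costs at most \<open>\<delta> t\<close> of edge: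
  the learner still has edge at least \<open>\<gamma> t - \<delta> t > 0\<close> under \<open>q t\<close>. The classical AdaBoost analysis
  then applies: a round whose edge under \<open>q t\<close> is \<open>e\<close> multiplies the exponential loss by
  \<open>sqrt (1 - 4 * e\<^sup>2) \<le> exp (- 2 * e\<^sup>2)\<close>.
\<close>

section \<open>Pinsker's inequality from exponential moments\<close>

text \<open>Termwise, \<open>ln r <= r - 1\<close> is applied to the ratio \<open>r\<close> of the
  tilted distribution \<open>q $ i * exp (\<phi> i) / Z\<close> to \<open>w $ i\<close>. Both
  distributions have total mass 1, so the upper bounds sum to 0.\<close>

lemma donsker_varadhan:
  fixes w q :: "real ^ 'n::finite" and \<phi> :: "'n \<Rightarrow> real"
  assumes w: "w \<in> prob_simplex" and q: "\<And>i. 0 < q $ i"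
  shows "(\<Sum>i\<in>UNIV. w $ i * \<phi> i) \<le> KL w q + ln (\<Sum>i\<in>UNIV. q $ i * exp (\<phi> i))"
proof -
  define Z where "Z = (\<Sum>i\<in>UNIV. q $ i * exp (\<phi> i))"
  have Z: "0 < Z"
    unfolding Z_def by (intro sum_pos) (auto simp: q)
  have w0: "0 \<le> w $ i" for i
    using w by (simp add: prob_simplex_def)
  have w1: "(\<Sum>i\<in>UNIV. w $ i) = 1"
    using w by (simp add: prob_simplex_def)
  have "w $ i * \<phi> i - w $ i * ln (w $ i / q $ i) - w $ i * ln Z
      \<le> q $ i * exp (\<phi> i) / Z - w $ i" for i
  proof (cases "w $ i = 0")
    \<comment> \<open>The ratio would have denominator 0 here; the left side vanishes and the right
      side is positive.\<close>
    case True
    then show ?thesis using q[of i] Z by simp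
  next
    case False
    then have wi: "0 < w $ i" using w0[of i] by simp
    have "\<phi> i - ln (w $ i / q $ i) - ln Z = ln (q $ i * exp (\<phi> i) / (w $ i * Z))"
      using wi q[of i] Z by (simp add: ln_div ln_mult)
    also have "\<dots> \<le> q $ i * exp (\<phi> i) / (w $ i * Z) - 1"
      using wi q[of i] Z by (intro ln_le_minus_one) simp
    finally have "w $ i * (\<phi> i - ln (w $ i / q $ i) - ln Z)
        \<le> w $ i * (q $ i * exp (\<phi> i) / (w $ i * Z) - 1)"
      using wi by (intro mult_left_mono) auto
    then show ?thesis
      using wi Z by (simp add: right_diff_distrib)
  qed
  then have "(\<Sum>i\<in>UNIV. w $ i * \<phi> i - w $ i * ln (w $ i / q $ i) - w $ i * ln Z)
      \<le> (\<Sum>i\<in>UNIV. q $ i * exp (\<phi> i) / Z - w $ i)"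
    by (intro sum_mono)
  also have "\<dots> = 0"
    using Z w1 by (simp add: sum_subtractf flip: sum_divide_distrib Z_def)
  finally show ?thesis
    using w1 by (simp add: sum_subtractf KL_def flip: sum_distrib_right Z_def)
qed

text \<open>Testing the variational bound on multiples of the indicator of a set leaves the log
  moment generating function of a Bernoulli variable, which Hoeffding's lemma bounds by a quadratic.
  The form for single events keeps the sharp constant 2.\<close>

lemma pinsker:
  fixes w q :: "real ^ 'n::finite"
  assumes w: "w \<in> prob_simplex" and q: "q \<in> prob_simplex" "\<And>i. 0 < q $ i"
  shows "2 * ((\<Sum>i\<in>A. w $ i) - (\<Sum>i\<in>A. q $ i))\<^sup>2 \<le> KL w q"
proof -
  \<comment> \<open>\<open>Hoeffdings_lemma_aux\<close> asks for \<open>0 <= l\<close>, so the set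
    is first taken to be one on which \<open>w\<close> has at least the mass of
    \<open>q\<close>.\<close>
  have one_sided: "2 * ((\<Sum>i\<in>B. w $ i) - (\<Sum>i\<in>B. q $ i))\<^sup>2 \<le> KL w q"
    if le: "(\<Sum>i\<in>B. q $ i) \<le> (\<Sum>i\<in>B. w $ i)" for B
  proof -
    define p where "p = (\<Sum>i\<in>B. q $ i)"
    define d where "d = (\<Sum>i\<in>B. w $ i) - p"
    \<comment> \<open>This \<open>l\<close> maximises \<open>l * d - l\<^sup>2 / 8\<close>.\<close>
    define l where "l = 4 * d"
    have p: "0 \<le> p" unfolding p_def using q(2) by (intro sum_nonneg) (simp add: less_imp_le)
    have l: "0 \<le> l" using le by (simp add: l_def d_def p_def)
    have "(\<Sum>i\<in>UNIV. q $ i * exp (l * indicator B i))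
        = (\<Sum>i\<in>UNIV. q $ i + (exp l - 1) * (q $ i * indicator B i))"
      by (intro sum.cong) (auto simp: indicator_def algebra_simps)
    also have "\<dots> = 1 + p * (exp l - 1)"
      using q(1) by (simp add: sum.distrib prob_simplex_def p_def mult.commute
          flip: sum_distrib_left sum.inter_restrict)
    finally have Z: "(\<Sum>i\<in>UNIV. q $ i * exp (l * indicator B i)) = 1 + p * (exp l - 1)" .
    have W: "(\<Sum>i\<in>UNIV. w $ i * (l * indicator B i)) = l * (d + p)"
      by (simp add: d_def mult.left_commute flip: sum_distrib_left)
    have "l * (d + p) \<le> KL w q + ln (1 + p * (exp l - 1))"
      using donsker_varadhan[OF w q(2), of "\<lambda>i. l * indicator B i"] by (simp only: Z W)
    moreover have "- l * p + ln (1 + p * (exp l - 1)) \<le> l\<^sup>2 / 8"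
      by (rule Hoeffdings_lemma_aux[OF l p])
    ultimately have "l * d - l\<^sup>2 / 8 \<le> KL w q"
      by (simp add: algebra_simps)
    then have "2 * d\<^sup>2 \<le> KL w q"
      by (simp add: l_def power2_eq_square)
    then show ?thesis
      by (simp add: d_def p_def)
  qed
  show ?thesis
  proof (cases "(\<Sum>i\<in>A. q $ i) \<le> (\<Sum>i\<in>A. w $ i)")
    case True
    then show ?thesis by (rule one_sided)
  next
    case False
    \<comment> \<open>Passing to the complement flips the sign of the mass difference and keeps its
      square.\<close>
    have compl: "(\<Sum>i\<in>-A. v $ i) = 1 - (\<Sum>i\<in>A. v $ i)"
      if "v \<in> prob_simplex" for v :: "real ^ 'n"
      using that sum.subset_diff[of A UNIV "\<lambda>i. v $ i"]
      by (simp add: prob_simplex_def Compl_eq_Diff_UNIV)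
    show ?thesis
      using one_sided[of "-A"] False by (simp add: compl w q(1) power2_commute)
  qed
qed

section \<open>Exponential loss and its normalised weights\<close>

lemma exp_loss_pos: "0 < exp_loss x y f"
  unfolding exp_loss_def by (intro sum_pos) auto

lemma exp_weights_pos: "0 < exp_weights x y f $ i"
  using exp_loss_pos[of x y f] by (simp add: exp_weights_def exp_loss_def)

lemma exp_weights_prob_simplex: "exp_weights x y f \<in> prob_simplex"
proof -
  have "(\<Sum>i\<in>UNIV. exp_weights x y f $ i) = 1"
    using exp_loss_pos[of x y f]
    by (simp add: exp_weights_def exp_loss_def flip: sum_divide_distrib)
  then show ?thesis
    by (simp add: prob_simplex_def exp_weights_pos less_imp_le)
qed

text \<open>The loss of \<open>f\<close> is the normalising constant of its exponential weights, so
  a round multiplies the loss by a mean under exactly these weights. This is why the error under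
  \<open>q t\<close>, not under \<open>w t\<close>, governs the decrease.\<close>

lemma exp_loss_add:
  "exp_loss x y (\<lambda>z. f z + c * u z) =
    exp_loss x y f * (\<Sum>i\<in>UNIV. exp_weights x y f $ i * exp (- c * (y i * u (x i))))"
proof -
  have "exp_loss x y f * exp_weights x y f $ i = exp (- y i * f (x i))" for i
    using exp_loss_pos[of x y f] by (simp add: exp_weights_def exp_loss_def)
  then have "exp_loss x y f * (exp_weights x y f $ i * exp (- c * (y i * u (x i))))
      = exp (- y i * f (x i)) * exp (- c * (y i * u (x i)))" for i
    by (simp only: mult.assoc[symmetric])
  also have "exp (- y i * f (x i)) * exp (- c * (y i * u (x i)))
      = exp (- y i * (f (x i) + c * u (x i)))" for i
    by (simp add: algebra_simps flip: exp_add)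
  finally have "exp_loss x y f * (exp_weights x y f $ i * exp (- c * (y i * u (x i))))
      = exp (- y i * (f (x i) + c * u (x i)))" for i .
  then show ?thesis
    by (simp add: exp_loss_def[of x y "\<lambda>z. f z + c * u z"] sum_distrib_left)
qed

section \<open>Edges and weighted errors\<close>

lemma label_mult_eq:
  assumes "y \<in> {-1, 1::real}" "u \<in> {-1, 1}"
  shows "y * u = (if y = u then 1 else -1)"
  using assms by auto

lemma edge_eq_half_minus_error:
  assumes y: "\<forall>i. y i \<in> {-1, 1}" and u: "\<forall>z. u z \<in> {-1, 1}" and v: "v \<in> prob_simplex"
  shows "edge x y v u = 1 / 2 - weighted_error x y v u"
proof -
  have "v $ i * (y i * u (x i)) = v $ i - 2 * (v $ i * of_bool (y i \<noteq> u (x i)))" for i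
    using label_mult_eq[of "y i" "u (x i)"] y u by auto
  then show ?thesis
    using v by (simp add: edge_def weighted_error_def prob_simplex_def sum_subtractf
        flip: sum_distrib_left)
qed

text \<open>The two edges differ, up to sign, by the difference of the masses of the misclassified
  set. Pinsker's inequality for this one event gives the bound.\<close>

lemma edge_diff_le:
  assumes y: "\<forall>i. y i \<in> {-1, 1}" and u: "\<forall>z. u z \<in> {-1, 1}"
    and w: "w \<in> prob_simplex" and q: "q \<in> prob_simplex" "\<And>i. 0 < q $ i"
  shows "\<bar>edge x y w u - edge x y q u\<bar> \<le> sqrt (KL w q / 2)"
proof -
  define A where "A = {i. y i \<noteq> u (x i)}"
  have err: "weighted_error x y v u = (\<Sum>i\<in>A. v $ i)" for v
    by (simp add: weighted_error_def A_def sum.If_cases of_bool_def if_distrib cong: if_cong)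
  have "edge x y w u - edge x y q u = - ((\<Sum>i\<in>A. w $ i) - (\<Sum>i\<in>A. q $ i))"
    by (simp add: edge_eq_half_minus_error[OF y u w] edge_eq_half_minus_error[OF y u q(1)] err)
  moreover have "2 * ((\<Sum>i\<in>A. w $ i) - (\<Sum>i\<in>A. q $ i))\<^sup>2 \<le> KL w q"
    by (rule pinsker[OF w q])
  ultimately have "(edge x y w u - edge x y q u)\<^sup>2 \<le> KL w q / 2"
    by (simp add: power2_commute)
  then show ?thesis
    using real_le_rsqrt[of "\<bar>edge x y w u - edge x y q u\<bar>"] by simp
qed

section \<open>Decrease of the loss in one round\<close>

text \<open>This \<open>c\<close> balances the two summands: each equals
  \<open>sqrt (e * (1 - e))\<close>. Comparing squares avoids the root and leaves
  \<open>4 * e * (1 - e) = 1 - 4 * (1 / 2 - e)\<^sup>2\<close>, to which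
  \<open>1 + z <= exp z\<close> applies.\<close>

lemma boosting_factor_le:
  fixes e :: real
  assumes e: "0 < e" "e < 1"
  defines "c \<equiv> 1 / 2 * ln ((1 - e) / e)"
  shows "(1 - e) * exp (- c) + e * exp c \<le> exp (- 2 * (1 / 2 - e)\<^sup>2)"
proof (rule power2_le_imp_le)
  define s where "s = exp c"
  have s: "0 < s" by (simp add: s_def)
  have "s\<^sup>2 = exp (2 * c)"
    by (simp add: s_def flip: exp_double)
  also have "\<dots> = (1 - e) / e"
    using e by (simp add: c_def)
  finally have s2: "e * s\<^sup>2 = 1 - e"
    using e by simp
  have "(1 - e) * exp (- c) + e * exp c = 2 * e * s"
    unfolding s2[symmetric] using s by (simp add: exp_minus flip: s_def)
      (simp add: field_simps power2_eq_square)
  then have "((1 - e) * exp (- c) + e * exp c)\<^sup>2 = 4 * e * (e * s\<^sup>2)"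
    by (simp add: power2_eq_square)
  also have "\<dots> = 1 + (- 4 * (1 / 2 - e)\<^sup>2)"
    unfolding s2 by (simp add: power2_eq_square field_simps)
  also have "\<dots> \<le> exp (- 4 * (1 / 2 - e)\<^sup>2)"
    by (rule exp_ge_add_one_self)
  also have "\<dots> = (exp (- 2 * (1 / 2 - e)\<^sup>2))\<^sup>2"
    by (simp flip: exp_double)
  finally show "((1 - e) * exp (- c) + e * exp c)\<^sup>2 \<le> (exp (- 2 * (1 / 2 - e)\<^sup>2))\<^sup>2" .
qed simp

lemma exp_loss_boosting_step:
  fixes x :: "'n::finite \<Rightarrow> 'x" and f u :: "'x \<Rightarrow> real"
  assumes y: "\<forall>i. y i \<in> {-1, 1}" and u: "\<forall>z. u z \<in> {-1, 1}"
  defines "q \<equiv> exp_weights x y f"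
  defines "e \<equiv> weighted_error x y q u"
  assumes e: "0 < e" "e < 1"
  shows "exp_loss x y (\<lambda>z. f z + 1 / 2 * ln ((1 - e) / e) * u z)
    \<le> exp_loss x y f * exp (- 2 * (edge x y q u)\<^sup>2)"
proof -
  define c where "c = 1 / 2 * ln ((1 - e) / e)"
  have q: "q \<in> prob_simplex"
    by (simp add: q_def exp_weights_prob_simplex)
  \<comment> \<open>The margin \<open>y i * u (x i)\<close> is 1 or -1, so its exponential is affine
    in the error indicator and the mean depends only on \<open>e\<close>.\<close>
  have "q $ i * exp (- c * (y i * u (x i)))
      = exp (- c) * q $ i + (exp c - exp (- c)) * (q $ i * of_bool (y i \<noteq> u (x i)))" for i
    using label_mult_eq[of "y i" "u (x i)"] y u by (auto simp: algebra_simps)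
  then have "(\<Sum>i\<in>UNIV. q $ i * exp (- c * (y i * u (x i))))
      = exp (- c) * (\<Sum>i\<in>UNIV. q $ i) + (exp c - exp (- c)) * e"
    by (simp only: sum.distrib e_def weighted_error_def flip: sum_distrib_left)
  also have "\<dots> = (1 - e) * exp (- c) + e * exp c"
    using q by (simp add: prob_simplex_def algebra_simps)
  also have "\<dots> \<le> exp (- 2 * (1 / 2 - e)\<^sup>2)"
    unfolding c_def by (rule boosting_factor_le[OF e])
  finally have "(\<Sum>i\<in>UNIV. q $ i * exp (- c * (y i * u (x i)))) \<le> exp (- 2 * (edge x y q u)\<^sup>2)"
    by (simp add: edge_eq_half_minus_error[OF y u q] e_def)
  then have "exp_loss x y (\<lambda>z. f z + c * u z)
      \<le> exp_loss x y f * exp (- 2 * (edge x y q u)\<^sup>2)"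
    unfolding exp_loss_add q_def
    using exp_loss_pos[of x y f] by (intro mult_left_mono) auto
  then show ?thesis unfolding c_def .
qed

text \<open>An error means a nonpositive margin, where the exponential is at least 1. A tie fits
  this too: labels are nonzero, so it counts as an error, and its exponential is exactly 1.\<close>

lemma training_error_le_exp_loss:
  fixes x :: "'n::finite \<Rightarrow> 'x"
  assumes y: "\<forall>i. y i \<in> {-1, 1}"
  shows "training_error x y f \<le> exp_loss x y f / real CARD('n)"
proof -
  have "of_bool (sgn (f (x i)) \<noteq> y i) \<le> exp (- y i * f (x i))" for i
  proof (cases "sgn (f (x i)) = y i")
    case False
    then have "y i * f (x i) \<le> 0"
      using y[rule_format, of i] by (auto simp: sgn_if split: if_splits)
    then show ?thesis by simp
  qed simp
  then have "(\<Sum>i\<in>UNIV. of_bool (sgn (f (x i)) \<noteq> y i)) \<le> exp_loss x y f"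
    unfolding exp_loss_def by (intro sum_mono)
  then show ?thesis
    by (simp add: training_error_def divide_right_mono)
qed

section \<open>Combining all rounds\<close>

theorem theorem5p4:
  fixes x :: "'n::finite \<Rightarrow> 'x" and a :: "'n \<Rightarrow> 'a" and y :: "'n \<Rightarrow> real"
    and H :: "('x \<Rightarrow> real) set"
    and K :: nat and g :: "nat \<Rightarrow> 'n \<Rightarrow> real" and G \<epsilon> :: real
    and T :: nat and q w :: "nat \<Rightarrow> real ^ 'n" and h :: "nat \<Rightarrow> 'x \<Rightarrow> real"
    and \<alpha> :: "nat \<Rightarrow> real" and f :: "nat \<Rightarrow> 'x \<Rightarrow> real"
    and \<gamma> \<delta> :: "nat \<Rightarrow> real"
  assumes labels: "\<forall>i. y i \<in> {-1, 1}"
    and learners: "\<forall>u\<in>H. \<forall>z. u z \<in> {-1, 1}"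
    and bounded: "\<forall>k\<in>{1..K}. \<forall>i. \<bar>g k i\<bar> \<le> G"
    and eps: "\<epsilon> > 0"
    and nonempty: "constraint_set K g \<epsilon> \<noteq> {}"
    and run: "fair_boosting_run x y H K g \<epsilon> T q w h \<alpha> f"
    and gamma: "\<forall>t\<in>{1..T}. \<gamma> t = edge x y (w t) (h t)"
    and delta: "\<forall>t\<in>{1..T}. \<delta> t = sqrt (KL (w t) (q t) / 2)"
    and edges: "\<forall>t\<in>{1..T}. \<gamma> t > \<delta> t"
  shows "exp_loss x y (f T) \<le> real CARD('n) * exp (- 2 * (\<Sum>t=1..T. (\<gamma> t - \<delta> t)\<^sup>2))
    \<and> training_error x y (f T) \<le> exp (- 2 * (\<Sum>t=1..T. (\<gamma> t - \<delta> t)\<^sup>2))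
    \<and> (\<forall>k\<in>{1..K}. \<forall>t\<in>{1..T}. \<bar>\<Sum>i\<in>UNIV. w t $ i * g k i\<bar> \<le> \<epsilon>)"
proof -
  have step: "q t = exp_weights x y (f (t - 1))" "w t \<in> constraint_set K g \<epsilon>" "h t \<in> H"
      "0 < weighted_error x y (q t) (h t)" "weighted_error x y (q t) (h t) < 1 / 2"
      "\<alpha> t = 1 / 2 * ln ((1 - weighted_error x y (q t) (h t)) / weighted_error x y (q t) (h t))"
      "f t = (\<lambda>z. f (t - 1) z + \<alpha> t * h t z)"
    if "t \<in> {1..T}" for t
    using bspec[OF conjunct2[OF run[unfolded fair_boosting_run_def is_arg_min_def]] that]
    by - (elim conjE, assumption)+
  have shrink: "exp_loss x y (f t) \<le> exp_loss x y (f (t - 1)) * exp (- 2 * (\<gamma> t - \<delta> t)\<^sup>2)"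
    if t: "t \<in> {1..T}" for t
  proof -
    note st = step[OF t]
    have u: "\<forall>z. h t z \<in> {-1, 1}"
      using learners st(3) by blast
    have "w t \<in> prob_simplex"
      using st(2) by (simp add: constraint_set_def)
    then have "\<bar>edge x y (w t) (h t) - edge x y (q t) (h t)\<bar> \<le> sqrt (KL (w t) (q t) / 2)"
      by (rule edge_diff_le[OF labels u])
        (simp_all add: st(1) exp_weights_prob_simplex exp_weights_pos)
    then have "\<gamma> t - \<delta> t \<le> edge x y (q t) (h t)"
      using gamma delta t by auto
    \<comment> \<open>Positivity lets the lower bound on the edge survive squaring.\<close>
    moreover have "0 < \<gamma> t - \<delta> t"
      using edges t by auto
    ultimately have "(\<gamma> t - \<delta> t)\<^sup>2 \<le> (edge x y (q t) (h t))\<^sup>2"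
      by (intro power_mono) auto
    then have le: "exp (- 2 * (edge x y (q t) (h t))\<^sup>2) \<le> exp (- 2 * (\<gamma> t - \<delta> t)\<^sup>2)"
      by simp
    have "exp_loss x y (f t) \<le> exp_loss x y (f (t - 1)) * exp (- 2 * (edge x y (q t) (h t))\<^sup>2)"
      unfolding st(7) st(6) using exp_loss_boosting_step[OF labels u, of x "f (t - 1)"] st(4,5)
      unfolding st(1) by simp
    also have "\<dots> \<le> exp_loss x y (f (t - 1)) * exp (- 2 * (\<gamma> t - \<delta> t)\<^sup>2)"
      using le exp_loss_pos[of x y "f (t - 1)"] by (intro mult_left_mono) auto
    finally show ?thesis .
  qed
  \<comment> \<open>The induction stops at \<open>T\<close> because \<open>shrink\<close> covers
    only completed rounds. At \<open>s = 0\<close> each sample contributes \<open>exp 0 = 1\<close>,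
    which gives the factor \<open>CARD('n)\<close>.\<close>
  have "exp_loss x y (f s) \<le> real CARD('n) * exp (- 2 * (\<Sum>t=1..s. (\<gamma> t - \<delta> t)\<^sup>2))"
    if "s \<le> T" for s
    using that
  proof (induction s)
    case 0
    have "f 0 = (\<lambda>_. 0)"
      using run by (simp add: fair_boosting_run_def)
    then show ?case by (simp add: exp_loss_def)
  next
    case (Suc s)
    have "exp_loss x y (f (Suc s)) \<le> exp_loss x y (f s) * exp (- 2 * (\<gamma> (Suc s) - \<delta> (Suc s))\<^sup>2)"
      using shrink[of "Suc s"] Suc.prems by simp
    also have "\<dots> \<le> real CARD('n) * exp (- 2 * (\<Sum>t=1..s. (\<gamma> t - \<delta> t)\<^sup>2)) *
        exp (- 2 * (\<gamma> (Suc s) - \<delta> (Suc s))\<^sup>2)"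
      using Suc by (intro mult_right_mono) auto
    also have "\<dots> = real CARD('n) * exp (- 2 * (\<Sum>t=1..Suc s. (\<gamma> t - \<delta> t)\<^sup>2))"
      by (simp add: algebra_simps flip: exp_add)
    finally show ?case .
  qed
  then have loss: "exp_loss x y (f T) \<le> real CARD('n) * exp (- 2 * (\<Sum>t=1..T. (\<gamma> t - \<delta> t)\<^sup>2))"
    by simp
  have "training_error x y (f T) \<le> exp_loss x y (f T) / real CARD('n)"
    by (rule training_error_le_exp_loss[OF labels])
  also have "\<dots> \<le> exp (- 2 * (\<Sum>t=1..T. (\<gamma> t - \<delta> t)\<^sup>2))"
    using loss by (simp add: divide_le_eq mult.commute)
  finally have "training_error x y (f T) \<le> exp (- 2 * (\<Sum>t=1..T. (\<gamma> t - \<delta> t)\<^sup>2))" .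
  \<comment> \<open>A minimiser over the constraint set belongs to it.\<close>
  moreover have "\<forall>k\<in>{1..K}. \<forall>t\<in>{1..T}. \<bar>\<Sum>i\<in>UNIV. w t $ i * g k i\<bar> \<le> \<epsilon>"
    using step(2) by (simp add: constraint_set_def)
  ultimately show ?thesis
    using loss by blast
qed

end
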